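(* Let $A_x\in\mathbb R^{n\times n}$ (the value $A(x)$ of a coefficient function at a state $x$), $B\in\mathbb R^{n\times p}$, $R\in\mathbb R^{p\times p}$ with $R\succ0$, $Q\in\mathbb R^{n\times n}$ with $Q\succcurlyeq0$, and let $P\in\mathbb R^{n\times n}$ solve the Riccati equation $PA_x+A_x^{\mathsf T}P-PBR^{-1}B^{\mathsf T}P+Q=0$, so that with $Z:=A_x-BR^{-1}B^{\mathsf T}P$, $$\begin{bmatrix}A_x&-BR^{-1}B^{\mathsf T}\\-Q&-A_x^{\mathsf T}\end{bmatrix}\begin{bmatrix}I\\P\end{bmatrix}=\begin{bmatrix}I\\P\end{bmatrix}Z .$$ Assume $Z\in\mathcal S_{K,\omega}$ for constants $K$ and $\omega$. If for an $A_\Delta\in\mathbb R^{n\times n}$ there exist $Q_\Delta\in\mathbb R^{n\times n}$, $R_\Delta\in\mathbb R^{p\times p}$ and $E\in\mathbb R^{n\times n}$ such that $$\begin{bmatrix}A_x+A_\Delta&-B[R^{-1}+R_\Delta]B^{\mathsf T}\\-Q-Q_\Delta&-A_x^{\mathsf T}-A_\Delta^{\mathsf T}\end{bmatrix}\begin{bmatrix}I+E\\P\end{bmatrix}=\begin{bmatrix}I+E\\P\end{bmatrix}Z,$$ and if $\|E\|<1$, then $I+E$ is invertible and with $P_\Delta:=P(I+E)^{-1}$ it holds that $$A_x+A_\Delta-B[R^{-1}+R_\Delta]B^{\mathsf T}P_\Delta\in\mathcal S_{\tilde K,\omega},\qquad \tilde K=\frac{1+\|E\|}{1-\|E\|}K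.$$
   Context: $\|\cdot\|$ denotes the operator norm on $\mathbb R^{n\times n}$ induced by a fixed vector norm on $\mathbb R^n$. Definition: for given constants $K$ and $\omega$, a matrix $F\in\mathbb R^{n\times n}$ is in the class $\mathcal S_{K,\omega}$ if $\|e^{F\tau}\|\le Ke^{-\omega\tau}$ for all $\tau>0$. *)

theory Defs
  imports "HOL-Analysis.Analysis"
begin

text \<open>
  The vector norm is an arbitrary norm on \<open>\<real>\<^sup>n\<close>, not necessarily the Euclidean norm of the type
  class, so it is carried around as a function.
\<close>

definition vector_norm :: "('a::real_vector \<Rightarrow> real) \<Rightarrow> bool" where
  "vector_norm N \<longleftrightarrow>
     (\<forall>x. 0 \<le> N x) \<and> (\<forall>x. N x = 0 \<longleftrightarrow> x = 0) \<and>
     (\<forall>c x. N (c *\<^sub>R x) = \<bar>c\<bar> * N x) \<and> (\<forall>x y. N (x + y) \<le> N x + N y)"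

text \<open>The term at \<open>x = 0\<close> is \<open>0 / 0 = 0\<close> and does not affect the supremum (cf. \<^const>\<open>onorm\<close>).\<close>

definition induced_norm :: "(real^'n \<Rightarrow> real) \<Rightarrow> real^'n^'n \<Rightarrow> real" where
  "induced_norm N A = (SUP x. N (A *v x) / N x)"

text \<open>
  On the type \<open>real^'n^'n\<close> the operation \<open>*\<close> is entrywise, so neither \<open>A ^ k\<close> nor the library's
  \<^const>\<open>exp\<close> describes matrix powers or the matrix exponential.
\<close>

definition mat_exp :: "real^'n^'n \<Rightarrow> real^'n^'n" where
  "mat_exp A = (\<Sum>k. (((**) A ^^ k) (mat 1)) /\<^sub>R fact k)"

definition stable_class :: "(real^'n \<Rightarrow> real) \<Rightarrow> real \<Rightarrow> real \<Rightarrow> (real^'n^'n) set" where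
  "stable_class N K \<omega> = {F. \<forall>\<tau>>0. induced_norm N (mat_exp (\<tau> *\<^sub>R F)) \<le> K * exp (- \<omega> * \<tau>)}"

definition pos_def :: "real^'n^'n \<Rightarrow> bool" where
  "pos_def A \<longleftrightarrow> transpose A = A \<and> (\<forall>x. x \<noteq> 0 \<longrightarrow> 0 < x \<bullet> (A *v x))"

definition pos_semidef :: "real^'n^'n \<Rightarrow> bool" where
  "pos_semidef A \<longleftrightarrow> transpose A = A \<and> (\<forall>x. 0 \<le> x \<bullet> (A *v x))"

text \<open>Block matrices: \<^const>\<open>Inl\<close> indexes the first, \<^const>\<open>Inr\<close> the second block row or column.\<close>

definition block2x2 ::
  "real^'a^'m \<Rightarrow> real^'b^'m \<Rightarrow> real^'a^'l \<Rightarrow> real^'b^'l \<Rightarrow> real^('a + 'b)^('m + 'l)" where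
  "block2x2 M11 M12 M21 M22 =
     (\<chi> i j. case i of
        Inl r \<Rightarrow> (case j of Inl c \<Rightarrow> M11 $ r $ c | Inr c \<Rightarrow> M12 $ r $ c)
      | Inr r \<Rightarrow> (case j of Inl c \<Rightarrow> M21 $ r $ c | Inr c \<Rightarrow> M22 $ r $ c))"

definition block2x1 :: "real^'k^'m \<Rightarrow> real^'k^'l \<Rightarrow> real^'k^('m + 'l)" where
  "block2x1 X Y = (\<chi> i. case i of Inl r \<Rightarrow> X $ r | Inr r \<Rightarrow> Y $ r)"

end

theory Submission
  imports Defs
begin

text \<open>
  The first block row of the perturbed equation says that the perturbed closed-loop matrix \<open>F\<close>
  satisfies \<open>F (I + E) = (I + E) Z\<close>. Since \<open>N ((I + E) x) \<ge> (1 - \<parallel>E\<parallel>) N x\<close>, the matrix \<open>I + E\<close> is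
  injective, hence invertible, and its inverse has norm at most \<open>1 / (1 - \<parallel>E\<parallel>)\<close>. Thus \<open>F\<close> is similar
  to \<open>Z\<close>, and the bound follows from \<open>exp(\<tau>F) = (I + E) exp(\<tau>Z) (I + E)\<inverse>\<close>.
\<close>

section \<open>Matrix algebra\<close>

lemma matrix_add_rdistrib: "(A + B) ** C = A ** C + B ** C"
  for A B :: "'a::semiring_1^'m^'n"
  by (vector matrix_matrix_mult_def sum.distrib[symmetric] distrib_right)

lemma matrix_mul_uminus_left: "(- A) ** B = - (A ** B)"
  for A :: "'a::ring_1^'m^'n"
  by (vector matrix_matrix_mult_def sum_negf)

lemma matrix_diff_ldistrib: "A ** (B - C) = A ** B - A ** C"
  for A :: "'a::ring_1^'m^'n"
  by (vector matrix_matrix_mult_def sum_subtractf[symmetric] right_diff_distrib)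

lemma matrix_diff_rdistrib: "(A - B) ** C = A ** C - B ** C"
  for A B :: "'a::ring_1^'m^'n"
  by (vector matrix_matrix_mult_def sum_subtractf[symmetric] left_diff_distrib)

lemma matrix_scaleR_left: "(c *\<^sub>R A) ** B = c *\<^sub>R (A ** B)"
  for A :: "real^'m^'n"
  by (vector matrix_matrix_mult_def sum_distrib_left mult.assoc)

lemma matrix_scaleR_right: "A ** (c *\<^sub>R B) = c *\<^sub>R (A ** B)"
  for A :: "real^'m^'n"
  by (vector matrix_matrix_mult_def sum_distrib_left mult.left_commute)

text \<open>Linear maps between finite-dimensional spaces are bounded. Boundedness provides the
  growth bound for the terms of the exponential series and lets multiplication by a fixed matrix
  pass inside it.\<close>

lemma bounded_linear_matrix_mul_left: "bounded_linear (\<lambda>X. A ** X)"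
  for A :: "real^'m^'n"
  by (intro linear_conv_bounded_linear[THEN iffD1] linearI)
     (auto simp: matrix_add_ldistrib matrix_scaleR_right)

lemma bounded_linear_matrix_mul_right: "bounded_linear (\<lambda>X. X ** A)"
  for A :: "real^'m^'n"
  by (intro linear_conv_bounded_linear[THEN iffD1] linearI)
     (auto simp: matrix_add_rdistrib matrix_scaleR_left)

lemma matrix_inv_right: "A ** matrix_inv A = mat 1"
  and matrix_inv_left: "matrix_inv A ** A = mat 1"
  if "invertible A" for A :: "'a::semiring_1^'m^'n"
proof -
  have "A ** matrix_inv A = mat 1 \<and> matrix_inv A ** A = mat 1"
    using that unfolding invertible_def matrix_inv_def by (rule someI_ex)
  then show "A ** matrix_inv A = mat 1" "matrix_inv A ** A = mat 1"
    by auto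
qed

text \<open>The sum over the index type \<open>'a + 'b\<close> splits into a sum over the
  \<open>Inl\<close> indices and one over the \<open>Inr\<close> indices.\<close>

lemma block2x2_mul_block2x1:
  "block2x2 A B C D ** block2x1 X Y = block2x1 (A ** X + B ** Y) (C ** X + D ** Y)"
  unfolding block2x2_def block2x1_def matrix_matrix_mult_def
  by (simp add: vec_eq_iff UNIV_Plus_UNIV[symmetric] sum.Plus split: sum.split del: UNIV_Plus_UNIV)

lemma block2x1_mul: "block2x1 X Y ** Z = block2x1 (X ** Z) (Y ** Z)"
  unfolding block2x1_def matrix_matrix_mult_def
  by (simp add: vec_eq_iff split: sum.split)

lemma block2x1_inject: "block2x1 X Y = block2x1 X' Y' \<longleftrightarrow> X = X' \<and> Y = Y'"
  unfolding block2x1_def vec_eq_iff by (auto split: sum.split_asm sum.split)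

section \<open>Induced norms\<close>

lemma vector_norm_zero: "N 0 = 0" and vector_norm_nonneg: "0 \<le> N x"
  if "vector_norm N"
  using that unfolding vector_norm_def by blast+

lemma vector_norm_pos: "vector_norm N \<Longrightarrow> x \<noteq> 0 \<Longrightarrow> 0 < N x"
  unfolding vector_norm_def by (metis less_le)

text \<open>Equivalence of norms in finite dimension: expanding in the basis bounds \<open>N\<close>
  above, and compactness of the Euclidean unit sphere bounds it below.\<close>

lemma vector_norm_bounds:
  fixes N :: "'a::euclidean_space \<Rightarrow> real"
  assumes "vector_norm N"
  obtains c C where "0 < c" "\<And>x. c * norm x \<le> N x" "0 \<le> C" "\<And>x. N x \<le> C * norm x"
proof -
  note nonneg = vector_norm_nonneg[OF assms]
  have scale: "N (r *\<^sub>R x) = \<bar>r\<bar> * N x" and tri: "N (x + y) \<le> N x + N y" for x y r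
    using assms by (auto simp: vector_norm_def)
  define C where "C = (\<Sum>b\<in>Basis. N b)"
  have C0: "0 \<le> C"
    unfolding C_def by (simp add: nonneg sum_nonneg)
  have sum_le: "N (sum g S) \<le> (\<Sum>i\<in>S. N (g i))" if "finite S" for g :: "'a \<Rightarrow> 'a" and S
    using that by (induction S) (auto simp: vector_norm_zero[OF assms] intro: order_trans[OF tri])
  have upper: "N x \<le> C * norm x" for x
  proof -
    have "N x = N (\<Sum>b\<in>Basis. (x \<bullet> b) *\<^sub>R b)"
      by (simp add: euclidean_representation)
    also have "\<dots> \<le> (\<Sum>b\<in>Basis. \<bar>x \<bullet> b\<bar> * N b)"
      using sum_le[of Basis "\<lambda>b. (x \<bullet> b) *\<^sub>R b"] by (simp add: scale)
    also have "\<dots> \<le> (\<Sum>b\<in>Basis. norm x * N b)"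
      by (intro sum_mono mult_right_mono Basis_le_norm nonneg) auto
    finally show ?thesis
      by (simp add: C_def sum_distrib_left mult.commute)
  qed
  \<comment> \<open>The reverse triangle inequality combined with the upper bound makes
    \<open>N\<close> Lipschitz for the Euclidean norm, hence continuous.\<close>
  have "\<bar>N x - N y\<bar> \<le> C * norm (x - y)" for x y
  proof -
    have "N x \<le> N (x - y) + N y" "N y \<le> N (y - x) + N x"
      using tri[of "x - y" y] tri[of "y - x" x] by auto
    then show ?thesis
      using upper[of "x - y"] upper[of "y - x"] by (simp add: norm_minus_commute abs_le_iff)
  qed
  then have "C-lipschitz_on UNIV N"
    using C0 by (intro lipschitz_onI) (auto simp: dist_norm)
  then have "continuous_on (sphere 0 1) N"
    by (meson lipschitz_on_continuous_on continuous_on_subset subset_UNIV)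
  moreover have "sphere (0::'a) 1 \<noteq> {}"
    by simp
  \<comment> \<open>The minimum \<open>N u\<close> over the compact sphere serves as the constant
    \<open>c\<close>; it is positive because \<open>u\<close> is nonzero, and rescaling carries the
    bound to all vectors.\<close>
  ultimately obtain u where u: "u \<in> sphere 0 1" "\<And>y. y \<in> sphere 0 1 \<Longrightarrow> N u \<le> N y"
    using continuous_attains_inf[of "sphere 0 1" N] by auto
  have "0 < N u"
    using u(1) by (intro vector_norm_pos[OF assms]) auto
  moreover have "N u * norm x \<le> N x" for x
  proof (cases "x = 0")
    case False
    then have "N u \<le> N (x /\<^sub>R norm x)"
      by (intro u(2)) simp
    with False show ?thesis
      by (simp add: scale field_simps)
  qed (simp add: nonneg)
  ultimately show ?thesis
    using that C0 upper by blast
qed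

context
  fixes N :: "real^'n \<Rightarrow> real"
  assumes norm: "vector_norm N"
begin

text \<open>A real supremum dominates its quotients only if they are bounded above; equivalence of
  \<open>N\<close> with the Euclidean norm supplies such a bound.\<close>

lemma vector_norm_mult_le: "N (A *v x) \<le> induced_norm N A * N x"
proof (cases "x = 0")
  case False
  obtain c C where cC: "0 < c" "\<And>x. c * norm x \<le> N x" "0 \<le> C" "\<And>x. N x \<le> C * norm x"
    using vector_norm_bounds[OF norm] by blast
  obtain k where k: "0 \<le> k" "\<And>x. norm (A *v x) \<le> k * norm x"
    using linear_bounded_pos[OF matrix_vector_mul_linear[of A]] by (metis less_imp_le)
  \<comment> \<open>Pass from \<open>N\<close> to the Euclidean norm (factor \<open>C\<close>),
    apply the Euclidean bound \<open>k\<close> of \<open>A\<close>, and return to \<open>N\<close>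
    (factor \<open>1 / c\<close>).\<close>
  have "N (A *v y) / N y \<le> C * k / c" for y
  proof (cases "y = 0")
    case False
    have "N (A *v y) \<le> C * k * norm y"
      using cC(3) cC(4)[of "A *v y"] mult_left_mono[OF k(2)[of y] cC(3)] by (simp add: mult.assoc)
    also have "\<dots> \<le> C * k * (N y / c)"
      using cC(1) cC(2)[of y]
      by (intro mult_left_mono mult_nonneg_nonneg cC(3) k(1))
        (simp add: pos_le_divide_eq mult.commute)
    finally show ?thesis
      using vector_norm_pos[OF norm False] by (simp add: pos_divide_le_eq)
  qed (use cC(1,3) k(1) in \<open>simp add: vector_norm_zero[OF norm]\<close>)
  then have "bdd_above (range (\<lambda>y. N (A *v y) / N y))"
    by (intro bdd_aboveI[of _ "C * k / c"]) auto
  then have "N (A *v x) / N x \<le> induced_norm N A"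
    unfolding induced_norm_def by (intro cSUP_upper) auto
  then show ?thesis
    using vector_norm_pos[OF norm False] by (simp add: field_simps)
qed (simp add: vector_norm_zero[OF norm])

lemma induced_norm_le:
  assumes "0 \<le> c" "\<And>x. N (A *v x) \<le> c * N x"
  shows "induced_norm N A \<le> c"
  unfolding induced_norm_def
proof (rule cSUP_least)
  fix x
  show "N (A *v x) / N x \<le> c"
    using assms vector_norm_zero[OF norm] vector_norm_pos[OF norm, of x]
    by (cases "x = 0") (auto simp: pos_divide_le_eq)
qed simp

lemma induced_norm_nonneg: "0 \<le> induced_norm N A"
proof -
  \<comment> \<open>The all-ones vector is nonzero because index types are nonempty.\<close>
  obtain x :: "real^'n" where "x \<noteq> 0"
    using zero_neq_one by blast
  then have "0 < N x"
    by (rule vector_norm_pos[OF norm])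
  moreover have "0 \<le> induced_norm N A * N x"
    by (rule order_trans[OF vector_norm_nonneg[OF norm] vector_norm_mult_le])
  ultimately show ?thesis
    by (simp add: zero_le_mult_iff)
qed

lemma induced_norm_mult_le: "induced_norm N (A ** B) \<le> induced_norm N A * induced_norm N B"
proof (rule induced_norm_le)
  fix x
  have "N ((A ** B) *v x) \<le> induced_norm N A * N (B *v x)"
    using vector_norm_mult_le[of A "B *v x"] by (simp add: matrix_vector_mul_assoc)
  also have "\<dots> \<le> induced_norm N A * (induced_norm N B * N x)"
    by (intro mult_left_mono vector_norm_mult_le induced_norm_nonneg)
  finally show "N ((A ** B) *v x) \<le> induced_norm N A * induced_norm N B * N x"
    by (simp add: mult.assoc)
qed (simp add: induced_norm_nonneg)

lemma induced_norm_one_plus_le: "induced_norm N (mat 1 + E) \<le> 1 + induced_norm N E"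
proof (rule induced_norm_le)
  fix x
  have "N ((mat 1 + E) *v x) \<le> N x + N (E *v x)"
    using norm by (simp add: vector_norm_def matrix_vector_mult_add_rdistrib)
  also have "\<dots> \<le> (1 + induced_norm N E) * N x"
    using vector_norm_mult_le[of E x] by (simp add: algebra_simps)
  finally show "N ((mat 1 + E) *v x) \<le> (1 + induced_norm N E) * N x" .
qed (simp add: induced_norm_nonneg add_nonneg_nonneg)

text \<open>Triangle inequality for \<open>x = (I + E) x - E x\<close>.\<close>

lemma vector_norm_one_plus_ge: "(1 - induced_norm N E) * N x \<le> N ((mat 1 + E) *v x)"
proof -
  have "N x = N ((mat 1 + E) *v x + (- 1) *\<^sub>R (E *v x))"
    by (simp add: matrix_vector_mult_add_rdistrib)
  also have "\<dots> \<le> N ((mat 1 + E) *v x) + N ((- 1) *\<^sub>R (E *v x))"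
    using norm unfolding vector_norm_def by blast
  also have "N ((- 1) *\<^sub>R (E *v x)) = N (E *v x)"
    using norm unfolding vector_norm_def by (metis abs_minus abs_one mult_1)
  finally show ?thesis
    using vector_norm_mult_le[of E x] by (simp add: algebra_simps)
qed

lemma
  assumes "induced_norm N E < 1"
  shows invertible_one_plus: "invertible (mat 1 + E)"
    and induced_norm_inv_one_plus_le:
      "induced_norm N (matrix_inv (mat 1 + E)) \<le> 1 / (1 - induced_norm N E)"
proof -
  have "x = 0" if "(mat 1 + E) *v x = 0" for x
  proof (rule ccontr)
    assume "x \<noteq> 0"
    then have "0 < (1 - induced_norm N E) * N x"
      using assms by (simp add: vector_norm_pos[OF norm])
    also note vector_norm_one_plus_ge[of E x]
    also have "N ((mat 1 + E) *v x) = 0"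
      by (simp add: that vector_norm_zero[OF norm])
    finally show False
      by simp
  qed
  then show inv: "invertible (mat 1 + E)"
    by (simp add: invertible_left_inverse matrix_left_invertible_ker)
  show "induced_norm N (matrix_inv (mat 1 + E)) \<le> 1 / (1 - induced_norm N E)"
  proof (rule induced_norm_le)
    fix x
    show "N (matrix_inv (mat 1 + E) *v x) \<le> 1 / (1 - induced_norm N E) * N x"
      \<comment> \<open>The lower bound at the vector \<open>(I + E)\<inverse> x\<close>, whose
        image under \<open>I + E\<close> is \<open>x\<close>.\<close>
      using vector_norm_one_plus_ge[of E "matrix_inv (mat 1 + E) *v x"] assms
      by (simp add: matrix_vector_mul_assoc matrix_inv_right[OF inv] pos_le_divide_eq mult.commute)
  qed (use assms in simp)
qed

end

section \<open>The matrix exponential under similarity\<close>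

text \<open>With \<open>c\<close> a bound for the linear map \<open>X \<mapsto> A ** X\<close>, the
  k-th power has norm at most a constant times \<open>c ^ k\<close>, so the real exponential series
  at \<open>c\<close> is a majorant.\<close>

lemma summable_mat_exp: "summable (\<lambda>k. (((**) A ^^ k) (mat 1)) /\<^sub>R fact k)"
  for A :: "real^'n^'n"
proof -
  obtain c where c: "0 \<le> c" "\<And>X :: real^'n^'n. norm (A ** X) \<le> norm X * c"
    using bounded_linear.nonneg_bounded[OF bounded_linear_matrix_mul_left[of A]] by blast
  have pow: "norm (((**) A ^^ k) (mat 1)) \<le> norm (mat 1 :: real^'n^'n) * c ^ k" for k
  proof (induction k)
    case (Suc k)
    show ?case
      using c(2)[of "((**) A ^^ k) (mat 1)"] mult_right_mono[OF Suc c(1)]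
      by (simp add: algebra_simps)
  qed simp
  have bound: "norm ((((**) A ^^ k) (mat 1)) /\<^sub>R fact k)
      \<le> norm (mat 1 :: real^'n^'n) * (inverse (fact k) * c ^ k)" for k
    using mult_left_mono[OF pow[of k], of "inverse (fact k)"] by (simp add: algebra_simps)
  have "summable (\<lambda>k. norm (mat 1 :: real^'n^'n) * (inverse (fact k) * c ^ k))"
    by (intro summable_mult summable_exp)
  then show ?thesis
    by (rule summable_comparison_test'[where N = 0]) (rule bound)
qed

text \<open>In powers of \<open>S ** A ** T\<close> the inner factors \<open>T ** S\<close> cancel,
  so each term of the series is conjugated; the bounded linear map
  \<open>X \<mapsto> S ** X ** T\<close> then commutes with the sum.\<close>

lemma mat_exp_similar:
  fixes A S T :: "real^'n^'n"
  assumes "S ** T = mat 1" "T ** S = mat 1"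
  shows "mat_exp (S ** A ** T) = S ** mat_exp A ** T"
proof -
  have pow: "((**) (S ** A ** T) ^^ k) (mat 1) = S ** ((**) A ^^ k) (mat 1) ** T" for k
  proof (induction k)
    case (Suc k)
    have "((**) (S ** A ** T) ^^ Suc k) (mat 1)
        = S ** A ** (T ** S) ** ((**) A ^^ k) (mat 1) ** T"
      using Suc by (simp add: matrix_mul_assoc)
    then show ?case
      using assms(2) by (simp add: matrix_mul_assoc)
  qed (use assms(1) in simp)
  have "bounded_linear (\<lambda>X. S ** X ** T)"
    using bounded_linear_compose[OF bounded_linear_matrix_mul_right bounded_linear_matrix_mul_left] .
  from bounded_linear.suminf[OF this summable_mat_exp[of A]] show ?thesis
    by (simp add: mat_exp_def pow matrix_scaleR_right matrix_scaleR_left)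
qed

lemma stable_class_similar:
  fixes N :: "real^'n \<Rightarrow> real" and F S T :: "real^'n^'n"
  assumes norm: "vector_norm N" and F: "F \<in> stable_class N K \<omega>"
    and ST: "S ** T = mat 1" "T ** S = mat 1"
    and s: "induced_norm N S \<le> s" and t: "induced_norm N T \<le> t"
  shows "S ** F ** T \<in> stable_class N (s * t * K) \<omega>"
  unfolding stable_class_def
proof (intro CollectI allI impI)
  fix \<tau> :: real
  assume "\<tau> > 0"
  then have F\<tau>: "induced_norm N (mat_exp (\<tau> *\<^sub>R F)) \<le> K * exp (- \<omega> * \<tau>)"
    using F by (simp add: stable_class_def)
  note nonneg = induced_norm_nonneg[OF norm]
  have "mat_exp (\<tau> *\<^sub>R (S ** F ** T)) = S ** mat_exp (\<tau> *\<^sub>R F) ** T"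
    using mat_exp_similar[OF ST, of "\<tau> *\<^sub>R F"] by (simp add: matrix_scaleR_right matrix_scaleR_left)
  also have "induced_norm N \<dots>
      \<le> induced_norm N S * induced_norm N (mat_exp (\<tau> *\<^sub>R F)) * induced_norm N T"
    by (intro order_trans[OF induced_norm_mult_le[OF norm]] mult_right_mono
        induced_norm_mult_le[OF norm] nonneg)
  also have "\<dots> \<le> s * (K * exp (- \<omega> * \<tau>)) * t"
    \<comment> \<open>The bounds \<open>s\<close>, \<open>t\<close> and
      \<open>K * exp (- \<omega> * \<tau>)\<close> are nonnegative since each dominates an induced
      norm; this covers \<open>K\<close> without a sign condition.\<close>
    using order_trans[OF nonneg s] order_trans[OF nonneg F\<tau>] F\<tau> s t
    by (intro mult_mono nonneg mult_nonneg_nonneg[of s] mult_nonneg_nonneg[OF nonneg nonneg])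
  finally show "induced_norm N (mat_exp (\<tau> *\<^sub>R (S ** F ** T))) \<le> s * t * K * exp (- \<omega> * \<tau>)"
    by (simp add: mult_ac)
qed

theorem theorem4p2:
  fixes N :: "real^'n \<Rightarrow> real"
    and A\<^sub>x Q P Z :: "real^'n^'n"
    and B :: "real^'p^'n"
    and R :: "real^'p^'p"
  assumes norm: "vector_norm N"
    and R: "pos_def R"
    and Q: "pos_semidef Q"
    and riccati: "P ** A\<^sub>x + transpose A\<^sub>x ** P
        - P ** B ** matrix_inv R ** transpose B ** P + Q = 0"
    and Z: "Z = A\<^sub>x - B ** matrix_inv R ** transpose B ** P"
  shows "block2x2 A\<^sub>x (- (B ** matrix_inv R ** transpose B)) (- Q) (- transpose A\<^sub>x)
           ** block2x1 (mat 1) P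
         = block2x1 (mat 1) P ** Z \<and>
    (\<forall>(K::real) (\<omega>::real). Z \<in> stable_class N K \<omega> \<longrightarrow>
      (\<forall>(A\<^sub>\<Delta> :: real^'n^'n) (Q\<^sub>\<Delta> :: real^'n^'n) (R\<^sub>\<Delta> :: real^'p^'p) (E :: real^'n^'n).
         block2x2 (A\<^sub>x + A\<^sub>\<Delta>) (- (B ** (matrix_inv R + R\<^sub>\<Delta>) ** transpose B))
                  (- Q - Q\<^sub>\<Delta>) (- transpose A\<^sub>x - transpose A\<^sub>\<Delta>)
             ** block2x1 (mat 1 + E) P
           = block2x1 (mat 1 + E) P ** Z
         \<and> induced_norm N E < 1 \<longrightarrow>
         invertible (mat 1 + E) \<and>
         (let P\<^sub>\<Delta> = P ** matrix_inv (mat 1 + E);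
              K' = (1 + induced_norm N E) / (1 - induced_norm N E) * K
          in A\<^sub>x + A\<^sub>\<Delta> - B ** (matrix_inv R + R\<^sub>\<Delta>) ** transpose B ** P\<^sub>\<Delta>
               \<in> stable_class N K' \<omega>)))"
proof (intro conjI allI impI)
  \<comment> \<open>The Riccati equation is exactly the second block row; the first is the
    definition of \<open>Z\<close>.\<close>
  have "P ** Z = - Q - transpose A\<^sub>x ** P"
    using riccati unfolding Z by (simp add: matrix_diff_ldistrib matrix_mul_assoc algebra_simps)
  then show "block2x2 A\<^sub>x (- (B ** matrix_inv R ** transpose B)) (- Q) (- transpose A\<^sub>x)
      ** block2x1 (mat 1) P = block2x1 (mat 1) P ** Z"
    by (simp add: block2x2_mul_block2x1 block2x1_mul block2x1_inject matrix_mul_uminus_left Z)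
next
  fix K \<omega> :: real and A\<^sub>\<Delta> Q\<^sub>\<Delta> E :: "real^'n^'n" and R\<^sub>\<Delta> :: "real^'p^'p"
  assume stable: "Z \<in> stable_class N K \<omega>"
  let ?G = "B ** (matrix_inv R + R\<^sub>\<Delta>) ** transpose B"
  let ?S = "mat 1 + E"
  let ?e = "induced_norm N E"
  assume "block2x2 (A\<^sub>x + A\<^sub>\<Delta>) (- ?G) (- Q - Q\<^sub>\<Delta>) (- transpose A\<^sub>x - transpose A\<^sub>\<Delta>)
      ** block2x1 ?S P = block2x1 ?S P ** Z \<and> ?e < 1"
  \<comment> \<open>First block row. Its term \<open>?G ** P\<close> equals
    \<open>?G ** P\<^sub>\<Delta> ** ?S\<close> once \<open>?S\<close> is known to be
    invertible.\<close>
  then have eq: "(A\<^sub>x + A\<^sub>\<Delta>) ** ?S - ?G ** P = ?S ** Z" and e: "?e < 1"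
    by (auto simp: block2x2_mul_block2x1 block2x1_mul block2x1_inject matrix_mul_uminus_left)
  show inv: "invertible ?S"
    by (rule invertible_one_plus[OF norm e])
  note inverse = matrix_inv_right[OF inv] matrix_inv_left[OF inv]
  \<comment> \<open>Multiplying the first block row by the inverse of \<open>?S\<close> on the right
    exhibits the closed-loop matrix as the conjugate of \<open>Z\<close> by
    \<open>?S\<close>.\<close>
  have "A\<^sub>x + A\<^sub>\<Delta> - ?G ** (P ** matrix_inv ?S)
      = ((A\<^sub>x + A\<^sub>\<Delta>) ** ?S - ?G ** P) ** matrix_inv ?S"
    using inverse(1) by (simp only: matrix_diff_rdistrib matrix_mul_assoc[symmetric] matrix_mul_rid)
  moreover have "(1 + ?e) * (1 / (1 - ?e)) * K = (1 + ?e) / (1 - ?e) * K"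
    by simp
  ultimately show "let P\<^sub>\<Delta> = P ** matrix_inv ?S; K' = (1 + ?e) / (1 - ?e) * K
      in A\<^sub>x + A\<^sub>\<Delta> - ?G ** P\<^sub>\<Delta> \<in> stable_class N K' \<omega>"
    using stable_class_similar[OF norm stable inverse induced_norm_one_plus_le[OF norm]
        induced_norm_inv_one_plus_le[OF norm e]]
    unfolding Let_def eq by simp
qed

end
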